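(* Let $n\ge 1$. Let $\Phi$ be the set of all $SPM(n)$-fixed points and $StrictPar$ the set of all strict partitions of $n$, both ordered by the dominance ordering $\le_B$. Then the dual map $d$ is a bijection between $\Phi$ and $StrictPar$. Moreover, $\Phi$ is a lattice, its maximal element is the fixed point $P_0$ of $SPM(n)$ (the $SPM(n)$-fixed point reached from $N=(n,0,\ldots,0)$), its minimal element is $(1,\ldots,1)$, and the dual map $d:\Phi\to StrictPar$ is an order anti-isomorphism, i.e. $P_1\ge_B P_2 \Leftrightarrow d(P_1)\le_B d(P_2)$ for all $P_1,P_2\in\Phi$.
   Context: A partition of $n$ is a sequence $a=(a_1,\ldots,a_n)$ of nonnegative integers with $a_1\ge a_2\ge\cdots\ge a_n$ and $\sum a_i=n$. The dominance ordering on partitions of $n$ is: $a\le_B b$ iff $\sum_{j=1}^i a_j\le\sum_{j=1}^i b_j$ for all $1\le i\le n$. The $SPM$ rule (vertical rule) transforms a partition $a$ into $(a_1,\ldots,a_i-1,a_{i+1}+1,\ldots,a_n)$ for an index $1\le i\le n-1$ with $a_i-a_{i+1}\ge 2$. An $SPM(n)$-fixed point is a partition of $n$ on which the $SPM$ rule cannot be applied at any position. $SPM(n)$ is the set of partitions obtained from $N=(n,0,\ldots,0)$ by iterating the $SPM$ rule; it contains a unique $SPM(n)$-fixed point, denoted $P_0$ and called the fixed point of $SPM(n)$. A strict partition of $n$ is a partition of $n$ whose nonzero parts are strictly decreasing (followed by zeros). The dual (conjugate) of a partition $a$ is $d(a)=(a_1^*,\ldots,a_n^* )$ with $a_i^*=|\{j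 : a_j\ge i\}|$. *)

theory Defs
  imports "HOL-Algebra.Lattice" "HOL-Library.Confluence"
begin

text \<open>A sequence \<open>(a\<^sub>1, \<dots>, a\<^sub>n)\<close> is a list of length \<open>n\<close>; the entry \<open>a\<^sub>i\<close> is \<open>a ! (i - 1)\<close>.\<close>

definition partitions :: "nat \<Rightarrow> nat list set" where
  "partitions n = {a. length a = n \<and> sorted_wrt (\<ge>) a \<and> sum_list a = n}"

definition dominance :: "nat \<Rightarrow> nat list \<Rightarrow> nat list \<Rightarrow> bool" where
  "dominance n a b \<longleftrightarrow> (\<forall>i\<in>{1..n}. sum_list (take i a) \<le> sum_list (take i b))"

definition dominance_order :: "nat \<Rightarrow> nat list set \<Rightarrow> nat list gorder" where
  "dominance_order n A = \<lparr>carrier = A, eq = (=), le = dominance n\<rparr>"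

definition spm_applicable :: "nat list \<Rightarrow> nat \<Rightarrow> bool" where
  "spm_applicable a i \<longleftrightarrow> Suc i < length a \<and> a ! i \<ge> a ! Suc i + 2"

definition spm_fire :: "nat list \<Rightarrow> nat \<Rightarrow> nat list" where
  "spm_fire a i = a[i := a ! i - 1, Suc i := a ! Suc i + 1]"

definition spm_step :: "nat list \<Rightarrow> nat list \<Rightarrow> bool" where
  "spm_step a b \<longleftrightarrow> (\<exists>i. spm_applicable a i \<and> b = spm_fire a i)"

definition SPM_start :: "nat \<Rightarrow> nat list" where
  "SPM_start n = n # replicate (n - 1) 0"

definition SPM :: "nat \<Rightarrow> nat list set" where
  "SPM n = {a. spm_step\<^sup>*\<^sup>* (SPM_start n) a}"

text \<open>All partitions of \<open>n\<close> on which the rule is blocked, whether or not they belong to \<open>SPM n\<close>.\<close>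

definition spm_fixed_points :: "nat \<Rightarrow> nat list set" where
  "spm_fixed_points n = {a \<in> partitions n. \<nexists>i. spm_applicable a i}"

text \<open>Well defined by \<open>ex1_SPM_fixed_point\<close> below.\<close>

definition SPM_fixed_point :: "nat \<Rightarrow> nat list" where
  "SPM_fixed_point n = (THE p. p \<in> SPM n \<and> p \<in> spm_fixed_points n)"

definition strict_partitions :: "nat \<Rightarrow> nat list set" where
  "strict_partitions n = {a \<in> partitions n. sorted_wrt (>) (filter (\<lambda>x. x \<noteq> 0) a)}"

definition dual :: "nat list \<Rightarrow> nat list" where
  "dual a = map (\<lambda>i. card {j. j < length a \<and> a ! j \<ge> i}) [1..<Suc (length a)]"

lemma length_spm_fire [simp]: "length (spm_fire a i) = length a"
  by (simp add: spm_fire_def)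

lemma spm_fire_commute:
  assumes "spm_applicable a i" "spm_applicable a j" "i < j"
  shows "spm_applicable (spm_fire a i) j" "spm_applicable (spm_fire a j) i"
    and "spm_fire (spm_fire a i) j = spm_fire (spm_fire a j) i"
proof -
  show "spm_applicable (spm_fire a i) j" "spm_applicable (spm_fire a j) i"
    using assms by (auto simp: spm_applicable_def spm_fire_def nth_list_update)
  show "spm_fire (spm_fire a i) j = spm_fire (spm_fire a j) i"
    using assms
    by (intro nth_equalityI) (auto simp: spm_applicable_def spm_fire_def nth_list_update)
qed

lemma spm_step_diamond:
  assumes "spm_step a b" "spm_step a c"
  shows "b = c \<or> (\<exists>u. spm_step b u \<and> spm_step c u)"
proof -
  obtain i j where ij: "spm_applicable a i" "b = spm_fire a i"
    "spm_applicable a j" "c = spm_fire a j"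
    using assms by (auto simp: spm_step_def)
  consider "i = j" | "i < j" | "j < i" by linarith
  then show ?thesis
  proof cases
    case 2
    then show ?thesis using spm_fire_commute[OF ij(1,3)] ij by (metis spm_step_def)
  next
    case 3
    then show ?thesis using spm_fire_commute[OF ij(3,1)] ij by (metis spm_step_def)
  qed (use ij in auto)
qed

lemma confluentp_spm_step: "confluentp spm_step"
proof (rule strong_confluentp_imp_confluentp, rule strong_confluentpI)
  fix x y z assume "spm_step x y" "spm_step x z"
  then show "\<exists>u. spm_step\<^sup>*\<^sup>* y u \<and> spm_step\<^sup>=\<^sup>= z u"
    using spm_step_diamond[of x y z] by blast
qed

lemma spm_step_lex:
  assumes "spm_step a b"
  shows "(b, a) \<in> lex less_than"
proof -
  obtain i where i: "spm_applicable a i" "b = spm_fire a i"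
    using assms by (auto simp: spm_step_def)
  have "take i b = take i a" "b ! i < a ! i" "i < length a"
    using i by (auto simp: spm_applicable_def spm_fire_def)
  then show ?thesis
    using i id_take_nth_drop[of i a] id_take_nth_drop[of i b]
    unfolding lex_conv
    by (intro CollectI case_prodI conjI) (simp, metis length_spm_fire in_measure less_than_iff)
qed

lemma spm_step_partitions:
  assumes "spm_step a b" "a \<in> partitions n"
  shows "b \<in> partitions n"
proof -
  obtain i where i: "Suc i < length a" "a ! i \<ge> a ! Suc i + 2" "b = spm_fire a i"
    using assms by (auto simp: spm_step_def spm_applicable_def)
  have "sum_list a \<ge> a ! i"
    using i by (intro member_le_sum_list) auto
  with i have "sum_list b = sum_list a"
    by (auto simp: spm_fire_def sum_list_update)
  moreover have "sorted_wrt (\<ge>) b"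
    using assms(2) i
    by (auto simp: partitions_def spm_fire_def sorted_wrt_iff_nth_Suc_transp nth_list_update
        transp_on_def)
       (metis One_nat_def Suc_lessD le_SucI le_diff_conv add.commute plus_1_eq_Suc le_trans)+
  ultimately show ?thesis
    using assms(2) i(3) by (auto simp: partitions_def)
qed

lemma SPM_start_partitions: "n \<ge> 1 \<Longrightarrow> SPM_start n \<in> partitions n"
  by (auto simp: SPM_start_def partitions_def sum_list_replicate sorted_wrt_iff_nth_less)

lemma SPM_subset_partitions:
  assumes "n \<ge> 1"
  shows "SPM n \<subseteq> partitions n"
proof
  fix a assume "a \<in> SPM n"
  then have "spm_step\<^sup>*\<^sup>* (SPM_start n) a" by (simp add: SPM_def)
  then show "a \<in> partitions n"
    by induction (use SPM_start_partitions[OF assms] spm_step_partitions in blast)+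
qed

lemma spm_reaches_blocked: "\<exists>p. spm_step\<^sup>*\<^sup>* a p \<and> (\<nexists>i. spm_applicable p i)"
proof (induction a rule: wf_induct_rule[OF wf_lex[OF wf_less_than]])
  case (1 a)
  then show ?case
    by (metis converse_rtranclp_into_rtranclp rtranclp.rtrancl_refl spm_step_def spm_step_lex)
qed

lemma ex1_SPM_fixed_point:
  assumes "n \<ge> 1"
  shows "\<exists>!p. p \<in> SPM n \<and> p \<in> spm_fixed_points n"
proof -
  obtain p where p: "spm_step\<^sup>*\<^sup>* (SPM_start n) p" "\<nexists>i. spm_applicable p i"
    using spm_reaches_blocked by blast
  have "q = p" if "q \<in> SPM n" "q \<in> spm_fixed_points n" for q
  proof -
    have q: "spm_step\<^sup>*\<^sup>* (SPM_start n) q" "\<nexists>i. spm_applicable q i"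
      using that by (auto simp: SPM_def spm_fixed_points_def)
    obtain u where "spm_step\<^sup>*\<^sup>* p u" "spm_step\<^sup>*\<^sup>* q u"
      using confluentpD[OF confluentp_spm_step p(1) q(1)] by blast
    with p(2) q(2) show ?thesis
      by (metis converse_rtranclpE spm_step_def)
  qed
  moreover have "p \<in> SPM n" "p \<in> spm_fixed_points n"
    using p SPM_subset_partitions[OF assms] by (auto simp: SPM_def spm_fixed_points_def)
  ultimately show ?thesis by blast
qed

end

(*
  Conjugation is an order-reversing involution of the partitions of n. The multiplicity of the part
  i in the conjugate of a is a_i - a_(i+1), so a is blocked iff its conjugate is strict. The minimum
  of the partial sums of two strict partitions comes from a strict partition, which gives joins of
  blocked partitions. A blocked partition dominated by a is still dominated after firing a, so the
  whole orbit of (n, 0, ..., 0), and in particular its end point, dominates every blocked partition.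
*)

theory Submission
  imports Defs
begin

section \<open>Partial sums and strictness of partitions\<close>

lemma sum_list_take_Suc:
  fixes a :: "nat list"
  shows "i < length a \<Longrightarrow> sum_list (take (Suc i) a) = sum_list (take i a) + a ! i"
  by (simp add: take_Suc_conv_app_nth)

lemma sum_list_take_le:
  fixes a :: "nat list"
  shows "sum_list (take i a) \<le> sum_list a"
  by (metis append_take_drop_id le_add1 sum_list_append)

lemma partitions_nth_mono:
  "\<lbrakk>a \<in> partitions n; i \<le> j; j < n\<rbrakk> \<Longrightarrow> a ! j \<le> a ! i"
  by (cases "i = j") (auto simp: partitions_def sorted_wrt_iff_nth_less)

lemma partitions_nth_le: "\<lbrakk>a \<in> partitions n; i < n\<rbrakk> \<Longrightarrow> a ! i \<le> n"
  using elem_le_sum_list[of i a] by (simp add: partitions_def)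

lemma finite_partitions: "finite (partitions n)"
proof (rule finite_subset)
  show "partitions n \<subseteq> {a. set a \<subseteq> {..n} \<and> length a = n}"
    using partitions_nth_le by (fastforce simp: partitions_def in_set_conv_nth)
qed (simp add: finite_lists_length_eq)

text \<open>Zeros come last in a partition, so weak decrease together with strictness on the nonzero
  parts amounts to the relation \<open>y \<noteq> 0 \<longrightarrow> y < x\<close>. It is
  transitive, so neighbours suffice.\<close>

lemma strict_partitions_iff:
  "a \<in> strict_partitions n \<longleftrightarrow> length a = n \<and> sum_list a = n \<and>
    (\<forall>i. Suc i < n \<longrightarrow> a ! Suc i \<noteq> 0 \<longrightarrow> a ! Suc i < a ! i)"
proof -
  have filter: "sorted_wrt (>) (filter (\<lambda>x. x \<noteq> 0) a) \<longleftrightarrow>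
      sorted_wrt (\<lambda>x y. x \<noteq> 0 \<longrightarrow> y \<noteq> 0 \<longrightarrow> y < x) a" for a :: "nat list"
    by (induction a) auto
  have "sorted_wrt (\<ge>) a \<and> sorted_wrt (>) (filter (\<lambda>x. x \<noteq> 0) a) \<longleftrightarrow>
      sorted_wrt (\<lambda>x y. y \<noteq> 0 \<longrightarrow> y < x) a" for a :: "nat list"
    unfolding filter by (fastforce simp: sorted_wrt_iff_nth_less)
  moreover have "sorted_wrt (\<lambda>x y. y \<noteq> 0 \<longrightarrow> y < x) a \<longleftrightarrow>
      (\<forall>i. Suc i < length a \<longrightarrow> a ! Suc i \<noteq> 0 \<longrightarrow> a ! Suc i < a ! i)" for a :: "nat list"
    by (intro sorted_wrt_iff_nth_Suc_transp) (auto simp: transp_on_def)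
  ultimately show ?thesis
    by (auto simp: strict_partitions_def partitions_def)
qed

section \<open>Dominance\<close>

lemma dominance_take:
  "\<lbrakk>dominance n a b; i \<le> n\<rbrakk> \<Longrightarrow> sum_list (take i a) \<le> sum_list (take i b)"
  by (cases "i = 0") (auto simp: dominance_def)

lemma dominance_refl [simp]: "dominance n a a"
  by (simp add: dominance_def)

lemma dominance_trans: "\<lbrakk>dominance n a b; dominance n b c\<rbrakk> \<Longrightarrow> dominance n a c"
  by (meson dominance_def le_trans)

lemma dominance_antisym:
  assumes "dominance n a b" "dominance n b a" "length a = n" "length b = n"
  shows "a = b"
proof (rule nth_equalityI)
  fix i assume i: "i < length a"
  have "sum_list (take k a) = sum_list (take k b)" if "k \<le> n" for k
    using that assms by (intro antisym dominance_take)
  from this[of i] this[of "Suc i"] show "a ! i = b ! i"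
    using i assms by (simp add: sum_list_take_Suc)
qed (use assms in simp)

text \<open>If the last of the first \<open>i\<close> entries is zero, these entries already sum to
  \<open>n\<close>; otherwise each of them is at least 1.\<close>

lemma replicate_1_least:
  assumes "a \<in> partitions n"
  shows "dominance n (replicate n 1) a"
  unfolding dominance_def
proof
  fix i assume i: "i \<in> {1..n}"
  have len: "length a = n" and sum: "sum_list a = n"
    using assms by (auto simp: partitions_def)
  show "sum_list (take i (replicate n 1)) \<le> sum_list (take i a)"
  proof (cases "a ! (i - 1) = 0")
    case True
    then have "a ! k = 0" if "k < n" "i \<le> k" for k
      using partitions_nth_mono[OF assms, of "i - 1" k] that by simp
    then have "sum_list (drop i a) = 0"
      using len by (auto simp: in_set_conv_nth)
    then have "sum_list (take i a) = n"
      using sum sum_list_append[of "take i a" "drop i a"] by simp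
    then show ?thesis using i by (simp add: sum_list_replicate)
  next
    case False
    have "1 \<le> a ! k" if "k < i" for k
      using False partitions_nth_mono[OF assms, of k "i - 1"] i that by fastforce
    then have "(\<Sum>k<i. 1) \<le> (\<Sum>k<i. a ! k)"
      by (intro sum_mono) auto
    then show ?thesis
      using i len by (simp add: sum_list_sum_nth sum_list_replicate atLeast0LessThan)
  qed
qed

lemma replicate_1_blocked: "replicate n 1 \<in> spm_fixed_points n"
  by (auto simp: spm_fixed_points_def partitions_def spm_applicable_def sorted_wrt_iff_nth_less
      sum_list_replicate)

text \<open>A blocked partition below \<open>a\<close> stays below: firing at \<open>i\<close> lowers only the partial sum
  \<open>a\<^sub>0 + \<dots> + a\<^sub>i\<close>, and if that one agreed with the one of \<open>p\<close>, then
  \<open>a\<^sub>i - a\<^sub>i\<^sub>+\<^sub>1 \<le> p\<^sub>i - p\<^sub>i\<^sub>+\<^sub>1 \<le> 1\<close>.\<close>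

lemma dominance_spm_step:
  assumes "dominance n p a" "spm_step a b" "\<nexists>i. spm_applicable p i"
    "length p = n" "length a = n"
  shows "dominance n p b"
  unfolding dominance_def
proof
  fix k assume k: "k \<in> {1..n}"
  obtain i where i: "Suc i < n" "a ! i \<ge> a ! Suc i + 2" and b: "b = spm_fire a i"
    using assms by (auto simp: spm_step_def spm_applicable_def)
  have p: "p ! i \<le> Suc (p ! Suc i)"
    using assms(3,4) i(1) by (force simp: spm_applicable_def not_le)
  have lt: "sum_list (take (Suc i) p) < sum_list (take (Suc i) a)"
    using dominance_take[OF assms(1), of i] dominance_take[OF assms(1), of "Suc i"]
      dominance_take[OF assms(1), of "Suc (Suc i)"] i p assms(4,5)
    by (simp add: sum_list_take_Suc)
  have b1: "sum_list (take m b) = sum_list (take m a)" if "m \<le> i" for m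
    using that by (simp add: b spm_fire_def)
  have b2: "sum_list (take (Suc i) b) = sum_list (take (Suc i) a) - 1"
    using b1[of i] i assms(5) by (simp add: sum_list_take_Suc b spm_fire_def)
  \<comment> \<open>From \<open>Suc (Suc i)\<close> on, a prefix contains both the unit removed and
    the unit added.\<close>
  have b3: "sum_list (take m b) = sum_list (take m a)" if "Suc (Suc i) \<le> m" "m \<le> n" for m
    using that
  proof (induction m rule: dec_induct)
    case base
    show ?case
      using b2 i assms(5) by (simp add: sum_list_take_Suc b spm_fire_def)
  next
    case (step m)
    then show ?case
      using assms(5) by (simp add: sum_list_take_Suc b spm_fire_def)
  qed
  consider "k \<le> i" | "k = Suc i" | "Suc (Suc i) \<le> k" by linarith
  then show "sum_list (take k p) \<le> sum_list (take k b)"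
    using b1 b2 b3 lt dominance_take[OF assms(1), of k] k by cases auto
qed

text \<open>Induction along the orbit: every nonempty prefix of the start sums to \<open>n\<close>,
  the largest possible value.\<close>

lemma SPM_dominates_blocked:
  assumes "n \<ge> 1" "p \<in> spm_fixed_points n" "a \<in> SPM n"
  shows "dominance n p a"
proof -
  have p: "length p = n" "sum_list p = n" "\<nexists>i. spm_applicable p i"
    using assms(2) by (auto simp: spm_fixed_points_def partitions_def)
  have "spm_step\<^sup>*\<^sup>* (SPM_start n) a"
    using assms(3) by (simp add: SPM_def)
  then show ?thesis
  proof induction
    case base
    have "sum_list (take i p) \<le> n" for i
      using p(2) sum_list_take_le[of i p] by simp
    then show ?case
      by (auto simp: dominance_def SPM_start_def take_Cons' intro: trans_le_add1)
  next
    case (step b c)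
    have "b \<in> partitions n"
      using step(1) SPM_subset_partitions[OF assms(1)] by (auto simp: SPM_def)
    then show ?case
      using dominance_spm_step[OF step(3,2) p(3,1)] by (simp add: partitions_def)
  qed
qed

section \<open>Conjugation\<close>

lemma length_dual [simp]: "length (dual a) = length a"
  by (simp add: dual_def del: upt_Suc)

lemma nth_dual: "i < length a \<Longrightarrow> dual a ! i = card {j. j < length a \<and> i < a ! j}"
  by (simp add: dual_def Suc_le_eq del: upt_Suc)

text \<open>Reflection of the Young diagram: as \<open>a\<close> is weakly decreasing, the indices
  with entry above \<open>j\<close> form an initial segment, and \<open>dual a ! j\<close> is its
  length.\<close>

lemma less_nth_dual_iff:
  assumes "a \<in> partitions n" "i < n" "j < n"
  shows "i < dual a ! j \<longleftrightarrow> j < a ! i"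
proof -
  have d: "dual a ! j = card {k. k < n \<and> j < a ! k}"
    using assms by (auto simp: nth_dual partitions_def)
  show ?thesis
  proof (cases "j < a ! i")
    case True
    then have "{..i} \<subseteq> {k. k < n \<and> j < a ! k}"
      using assms partitions_nth_mono[OF assms(1), of _ i]
      by (fastforce intro: less_le_trans)
    then have "card {..i} \<le> dual a ! j"
      unfolding d by (intro card_mono) auto
    then show ?thesis using True by simp
  next
    case False
    then have "{k. k < n \<and> j < a ! k} \<subseteq> {..<i}"
      using partitions_nth_mono[OF assms(1), of i] by (fastforce simp flip: not_le)
    then have "dual a ! j \<le> card {..<i}"
      unfolding d by (intro card_mono) auto
    then show ?thesis using False by simp
  qed
qed

text \<open>Double counting of the cells in the first \<open>m\<close> columns of the diagram: row
  \<open>k\<close> contributes \<open>min (a ! k) m\<close>.\<close>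

lemma sum_list_take_dual:
  assumes "m \<le> length a"
  shows "sum_list (take m (dual a)) = (\<Sum>k<length a. min (a ! k) m)"
  using assms
proof (induction m)
  case (Suc m)
  have "dual a ! m = (\<Sum>k<length a. of_bool (m < a ! k))"
    using Suc.prems by (simp add: nth_dual Int_def)
  moreover have "min (a ! k) (Suc m) = min (a ! k) m + of_bool (m < a ! k)" for k
    by auto
  ultimately show ?case
    using Suc by (simp add: sum_list_take_Suc sum.distrib)
qed simp

lemma dual_partitions:
  assumes "a \<in> partitions n"
  shows "dual a \<in> partitions n"
proof -
  have a: "length a = n" "sum_list a = n"
    using assms by (auto simp: partitions_def)
  have "sum_list (dual a) = (\<Sum>k<n. min (a ! k) n)"
    using sum_list_take_dual[of n a] a by simp
  also have "\<dots> = (\<Sum>k<n. a ! k)"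
    using partitions_nth_le[OF assms] by (intro sum.cong) auto
  finally have "sum_list (dual a) = n"
    using a by (simp add: sum_list_sum_nth atLeast0LessThan)
  moreover have "sorted_wrt (\<ge>) (dual a)"
    using a by (auto simp: sorted_wrt_iff_nth_less nth_dual intro!: card_mono)
  ultimately show ?thesis using a by (simp add: partitions_def)
qed

lemma dual_dual:
  assumes "a \<in> partitions n"
  shows "dual (dual a) = a"
proof (rule nth_equalityI)
  fix i assume "i < length (dual (dual a))"
  then have i: "i < n" and len: "length a = n"
    using assms by (auto simp: partitions_def)
  have "dual (dual a) ! i = card {j. j < n \<and> i < dual a ! j}"
    using i len by (simp add: nth_dual)
  \<comment> \<open>Since \<open>a ! i \<le> n\<close>, the bound \<open>j < n\<close> cuts nothing
    off.\<close>
  also have "{j. j < n \<and> i < dual a ! j} = {..<a ! i}"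
    using less_nth_dual_iff[OF assms i] partitions_nth_le[OF assms i] by auto
  finally show "dual (dual a) ! i = a ! i" by simp
qed simp

text \<open>The partial sums of the conjugate are \<open>n - \<Sum>\<^sub>k (a\<^sub>k - i)\<^sup>+\<close>, and
  \<open>\<Sum>\<^sub>k (a\<^sub>k - i)\<^sup>+\<close> is the maximum over \<open>m\<close> of
  \<open>a\<^sub>0 + \<dots> + a\<^sub>m\<^sub>-\<^sub>1 - m i\<close>, hence monotone for dominance.\<close>

lemma dominance_dual:
  assumes "a \<in> partitions n" "b \<in> partitions n" "dominance n a b"
  shows "dominance n (dual b) (dual a)"
  unfolding dominance_def
proof
  fix i assume i: "i \<in> {1..n}"
  have a: "length a = n" "sum_list a = n" and b: "length b = n" "sum_list b = n"
    using assms by (auto simp: partitions_def)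
  \<comment> \<open>The maximum for \<open>a\<close> is attained at the number of parts exceeding
    \<open>i\<close>. This is \<open>dual a ! i\<close> only for \<open>i < n\<close>; the index
    \<open>n\<close> lies outside the list, hence the case split below.\<close>
  define m where "m = card {k. k < n \<and> i < a ! k}"
  have m_le: "m \<le> n"
    using card_mono[of "{..<n}" "{k. k < n \<and> i < a ! k}"] by (auto simp: m_def)
  have m_iff: "i < a ! k \<longleftrightarrow> k < m" if "k < n" for k
  proof (cases "i = n")
    case True
    then have "\<not> i < a ! k" if "k < n" for k
      using partitions_nth_le[OF assms(1) that] by simp
    moreover from this have "{k. k < n \<and> i < a ! k} = {}"
      by blast
    ultimately show ?thesis
      unfolding m_def using that by (metis card.empty not_less0)
  next
    case False
    then show ?thesis
      using less_nth_dual_iff[OF assms(1) that, of i] i a by (simp add: m_def nth_dual)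
  qed
  have take: "sum_list (take m c) = (\<Sum>k<m. c ! k)" if "length c = n" for c :: "nat list"
    using that m_le by (simp add: sum_list_sum_nth atLeast0LessThan)
  have split: "(\<Sum>k<n. c ! k) = (\<Sum>k<n. min (c ! k) i) + (\<Sum>k<n. c ! k - i)" for c
    unfolding sum.distrib[symmetric] by (rule sum.cong) auto
  \<comment> \<open>At this \<open>m\<close> truncated subtraction is exact for \<open>a\<close>,
    which gives equalities; for \<open>b\<close> truncation and the terms beyond \<open>m\<close>
    can only enlarge the sum.\<close>
  have "(\<Sum>k<n. a ! k - i) + m * i = (\<Sum>k<m. a ! k - i) + (\<Sum>k<m. i)"
    using m_le m_iff by (simp, intro sum.mono_neutral_right) (auto simp flip: not_less)
  also have "\<dots> = (\<Sum>k<m. a ! k)"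
    unfolding sum.distrib[symmetric] using m_le m_iff by (intro sum.cong) (simp_all add: less_imp_le)
  also have "\<dots> \<le> (\<Sum>k<m. b ! k)"
    using dominance_take[OF assms(3) m_le] a b by (simp add: take)
  also have "\<dots> \<le> (\<Sum>k<m. (b ! k - i) + i)"
    by (intro sum_mono) simp
  also have "\<dots> = (\<Sum>k<m. b ! k - i) + m * i"
    by (simp add: sum.distrib)
  also have "\<dots> \<le> (\<Sum>k<n. b ! k - i) + m * i"
    using m_le by (intro add_right_mono sum_mono2) auto
  finally have "(\<Sum>k<n. a ! k - i) \<le> (\<Sum>k<n. b ! k - i)" by simp
  moreover have "(\<Sum>k<n. a ! k) = n" "(\<Sum>k<n. b ! k) = n"
    using a b by (simp_all add: sum_list_sum_nth atLeast0LessThan)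
  ultimately show "sum_list (take i (dual b)) \<le> sum_list (take i (dual a))"
    using i a b split[of a] split[of b] by (simp add: sum_list_take_dual)
qed

lemma dominance_dual_iff:
  "\<lbrakk>a \<in> partitions n; b \<in> partitions n\<rbrakk> \<Longrightarrow> dominance n (dual a) (dual b) \<longleftrightarrow> dominance n b a"
  by (metis dominance_dual dual_dual dual_partitions)

text \<open>Equal entries \<open>Suc c\<close> of the conjugate at \<open>i\<close> and
  \<open>Suc i\<close> would force \<open>a ! c \<ge> i + 2\<close> and
  \<open>a ! Suc c \<le> i\<close>, so the rule would apply at \<open>c\<close>.\<close>

lemma dual_spm_fixed_points:
  assumes "n \<ge> 1" "a \<in> spm_fixed_points n"
  shows "dual a \<in> strict_partitions n"
proof -
  have a: "a \<in> partitions n" "\<nexists>i. spm_applicable a i"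
    using assms by (auto simp: spm_fixed_points_def)
  have d: "length (dual a) = n" "sum_list (dual a) = n"
    using dual_partitions[OF a(1)] by (auto simp: partitions_def)
  have "dual a ! Suc i < dual a ! i" if i: "Suc i < n" and nz: "dual a ! Suc i \<noteq> 0" for i
  proof (rule ccontr)
    assume "\<not> ?thesis"
    moreover have "dual a ! Suc i \<le> dual a ! i"
      using partitions_nth_mono[OF dual_partitions[OF a(1)], of i "Suc i"] i by simp
    ultimately obtain c where c: "dual a ! i = Suc c" "dual a ! Suc i = Suc c"
      using nz by (metis le_antisym not_le not0_implies_Suc)
    \<comment> \<open>Two entries \<open>Suc c\<close> fit into the total, so
      \<open>2 * Suc c \<le> n\<close>.\<close>
    have cn: "Suc c < n"
      using sum_list_take_le[of "Suc (Suc i)" "dual a"] c i d by (simp add: sum_list_take_Suc)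
    have "Suc i < a ! c" "\<not> i < a ! Suc c"
      using less_nth_dual_iff[OF a(1), of c "Suc i"] less_nth_dual_iff[OF a(1), of "Suc c" i] c cn i
      by auto
    then show False
      using a cn by (auto simp: spm_applicable_def partitions_def)
  qed
  then show ?thesis using d by (simp add: strict_partitions_iff)
qed

lemma dual_strict_partitions:
  assumes "b \<in> strict_partitions n"
  shows "dual b \<in> spm_fixed_points n"
proof -
  have b: "b \<in> partitions n"
    using assms by (simp add: strict_partitions_def)
  have "\<not> spm_applicable (dual b) i" for i
  proof
    assume "spm_applicable (dual b) i"
    then have i: "Suc i < n" and *: "dual b ! Suc i + 2 \<le> dual b ! i"
      using b by (auto simp: spm_applicable_def partitions_def)
    \<comment> \<open>\<open>c\<close> counts the parts of \<open>b\<close> above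
      \<open>Suc i\<close>. At least two more parts exceed \<open>i\<close>, so positions
      \<open>c\<close> and \<open>Suc c\<close> both carry \<open>Suc i\<close>.\<close>
    define c where "c = dual b ! Suc i"
    have c: "Suc c < n"
      using * i partitions_nth_le[OF dual_partitions[OF b], of i] by (simp add: c_def)
    have "i < b ! Suc c" "\<not> Suc i < b ! c"
      using less_nth_dual_iff[OF dual_partitions[OF b], of i "Suc c"]
        less_nth_dual_iff[OF dual_partitions[OF b], of "Suc i" c] i c *
      by (auto simp: dual_dual[OF b] c_def)
    moreover have "b ! Suc c \<noteq> 0 \<longrightarrow> b ! Suc c < b ! c"
      using assms c by (simp add: strict_partitions_iff)
    ultimately show False by simp
  qed
  then show ?thesis
    using dual_partitions[OF b] by (simp add: spm_fixed_points_def)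
qed

section \<open>The lattice structure\<close>

text \<open>The pointwise minimum of the partial sums of two strict partitions is again strictly concave
  until it reaches \<open>n\<close>, so it is the sequence of partial sums of a strict partition.\<close>

lemma strict_partitions_inf:
  assumes "a \<in> strict_partitions n" "b \<in> strict_partitions n"
  obtains c where "c \<in> strict_partitions n" "dominance n c a" "dominance n c b"
    "\<And>d. \<lbrakk>dominance n d a; dominance n d b\<rbrakk> \<Longrightarrow> dominance n d c"
proof -
  define h where "h i = min (sum_list (take i a)) (sum_list (take i b))" for i
  \<comment> \<open>The differences are truncated; \<open>mono\<close> makes them exact, so that
    \<open>c\<close> has partial sums \<open>h\<close>.\<close>
  define c where "c = map (\<lambda>i. h (Suc i) - h i) [0..<n]"
  have a: "length a = n" "sum_list a = n" "\<And>i. Suc i < n \<Longrightarrow> a ! Suc i \<noteq> 0 \<Longrightarrow> a ! Suc i < a ! i"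
    and b: "length b = n" "sum_list b = n" "\<And>i. Suc i < n \<Longrightarrow> b ! Suc i \<noteq> 0 \<Longrightarrow> b ! Suc i < b ! i"
    using assms by (auto simp: strict_partitions_iff)
  have mono: "h i \<le> h (Suc i)" if "i < n" for i
    using that a b by (auto simp: h_def sum_list_take_Suc intro: min.coboundedI1 min.coboundedI2)
  have take: "sum_list (take i c) = h i" if "i \<le> n" for i
    using that
  proof (induction i)
    case (Suc i)
    then show ?case
      using mono[of i] by (simp add: sum_list_take_Suc c_def)
  qed (simp add: h_def)
  have "c ! Suc i < c ! i" if i: "Suc i < n" and nz: "c ! Suc i \<noteq> 0" for i
  proof -
    have le: "h k \<le> sum_list (take k a)" "h k \<le> sum_list (take k b)" for k
      by (auto simp: h_def)
    have aS: "sum_list (take (Suc k) a) = sum_list (take k a) + a ! k"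
      and bS: "sum_list (take (Suc k) b) = sum_list (take k b) + b ! k" if "k < n" for k
      using that a b by (simp_all add: sum_list_take_Suc)
    have lt: "h (Suc i) < h (Suc (Suc i))"
      using nz i by (simp add: c_def)
    \<comment> \<open>Where \<open>h\<close> meets the partial sums of one list, its neighbouring
      values lie weakly below those of that list, so strict concavity is inherited. The increase of
      \<open>h\<close> makes the entry at \<open>Suc i\<close> nonzero, so strictness applies
      there.\<close>
    consider "h (Suc i) = sum_list (take (Suc i) a)" | "h (Suc i) = sum_list (take (Suc i) b)"
      unfolding h_def by linarith
    then have "h (Suc (Suc i)) + h i < 2 * h (Suc i)"
    proof cases
      case 1
      have "a ! Suc i \<noteq> 0"
        using lt le(1)[of "Suc (Suc i)"] aS[of "Suc i"] 1 i by auto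
      then show ?thesis
        using a(3)[of i] i 1 le(1)[of i] le(1)[of "Suc (Suc i)"] aS[of i] aS[of "Suc i"] by simp
    next
      case 2
      have "b ! Suc i \<noteq> 0"
        using lt le(2)[of "Suc (Suc i)"] bS[of "Suc i"] 2 i by auto
      then show ?thesis
        using b(3)[of i] i 2 le(2)[of i] le(2)[of "Suc (Suc i)"] bS[of i] bS[of "Suc i"] by simp
    qed
    then show ?thesis
      using i mono[of i] mono[of "Suc i"] by (simp add: c_def)
  qed
  moreover have "sum_list c = n" "length c = n"
    using take[of n] a b by (simp_all add: c_def h_def)
  ultimately have "c \<in> strict_partitions n"
    by (simp add: strict_partitions_iff)
  moreover have "dominance n d c" if "dominance n d a" "dominance n d b" for d
    using that by (simp add: dominance_def take h_def)
  ultimately show ?thesis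
    by (intro that[of c]) (simp_all add: dominance_def take h_def)
qed

lemma partial_order_dominance:
  assumes "A \<subseteq> partitions n"
  shows "partial_order (dominance_order n A)"
proof
  fix x y
  assume "le (dominance_order n A) x y" "le (dominance_order n A) y x"
    "x \<in> carrier (dominance_order n A)" "y \<in> carrier (dominance_order n A)"
  then show "eq (dominance_order n A) x y"
    using assms by (auto simp: dominance_order_def partitions_def intro: dominance_antisym)
qed (auto simp: dominance_order_def intro: dominance_trans)

text \<open>Conjugation turns minima of strict partitions into joins of blocked ones; meets then exist
  because the set is finite and has a least element.\<close>

lemma lattice_spm_fixed_points:
  assumes "n \<ge> 1"
  shows "lattice (dominance_order n (spm_fixed_points n))" (is "lattice ?L")
proof -
  have sub: "spm_fixed_points n \<subseteq> partitions n"
    by (auto simp: spm_fixed_points_def)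
  interpret partial_order ?L
    by (rule partial_order_dominance[OF sub])
  have carrier [simp]: "carrier ?L = spm_fixed_points n" and le [simp]: "le ?L = dominance n"
    by (simp_all add: dominance_order_def)
  interpret weak_upper_semilattice ?L
  proof
    fix x y assume "x \<in> carrier ?L" "y \<in> carrier ?L"
    then have x: "x \<in> spm_fixed_points n" and y: "y \<in> spm_fixed_points n" by simp_all
    obtain c where c: "c \<in> strict_partitions n" "dominance n c (dual x)" "dominance n c (dual y)"
      "\<And>d. \<lbrakk>dominance n d (dual x); dominance n d (dual y)\<rbrakk> \<Longrightarrow> dominance n d c"
      using strict_partitions_inf[OF dual_spm_fixed_points[OF assms x]
          dual_spm_fixed_points[OF assms y]] by metis
    have cp: "c \<in> partitions n" using c(1) by (simp add: strict_partitions_def)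
    \<comment> \<open>Conjugating twice returns \<open>c\<close>, so comparisons with
      \<open>dual c\<close> reverse into comparisons with \<open>c\<close>, where its minimum
      property applies.\<close>
    have le_iff: "dominance n z (dual c) \<longleftrightarrow> dominance n c (dual z)"
      "dominance n (dual c) z \<longleftrightarrow> dominance n (dual z) c" if "z \<in> spm_fixed_points n" for z
      using dominance_dual_iff[of "dual c" n z] dominance_dual_iff[of z n "dual c"]
        dual_partitions[OF cp] dual_dual[OF cp] that sub by auto
    have "least ?L (dual c) (Upper ?L {x, y})"
    proof (rule least_UpperI)
      show "le ?L z (dual c)" if "z \<in> {x, y}" for z
        using that x y c le_iff by auto
      show "le ?L (dual c) z" if "z \<in> Upper ?L {x, y}" for z
      proof -
        have z: "z \<in> spm_fixed_points n" "dominance n x z" "dominance n y z"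
          using that x y by (auto simp: Upper_def)
        then show ?thesis
          using c(4)[of "dual z"] x y sub by (simp add: le_iff dominance_dual_iff subset_iff)
      qed
    qed (use x y dual_strict_partitions[OF c(1)] in auto)
    then show "\<exists>s. least ?L s (Upper ?L {x, y})" ..
  qed
  have "\<exists>s. greatest ?L s (Lower ?L {x, y})" if "x \<in> carrier ?L" "y \<in> carrier ?L" for x y
  proof -
    have xy: "x \<in> spm_fixed_points n" "y \<in> spm_fixed_points n" using that by simp_all
    \<comment> \<open>\<open>finite_sup_least\<close> asks for a nonempty set; the least element
      supplies a common lower bound.\<close>
    have "replicate n 1 \<in> Lower ?L {x, y}"
      using xy sub replicate_1_blocked[of n] replicate_1_least by (auto simp: Lower_def)
    moreover have "Lower ?L {x, y} \<subseteq> spm_fixed_points n"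
      by (auto simp: Lower_def)
    ultimately have l: "least ?L (\<Squnion>\<^bsub>?L\<^esub> (Lower ?L {x, y})) (Upper ?L (Lower ?L {x, y}))"
      using finite_subset[OF sub finite_partitions]
      by (intro finite_sup_least) (auto intro: finite_subset)
    \<comment> \<open>\<open>x\<close> and \<open>y\<close> are upper bounds of the set of their
      common lower bounds, so its join still lies below both and is their meet.\<close>
    have "greatest ?L (\<Squnion>\<^bsub>?L\<^esub> (Lower ?L {x, y})) (Lower ?L {x, y})"
      using l xy unfolding greatest_def least_def by (auto simp: Upper_def Lower_def)
    then show ?thesis ..
  qed
  then show ?thesis
    by unfold_locales (auto intro: sup_of_two_exists)
qed

theorem theorem1:
  fixes n :: nat
  assumes "n \<ge> 1"
  shows "bij_betw dual (spm_fixed_points n) (strict_partitions n) \<and>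
    lattice (dominance_order n (spm_fixed_points n)) \<and>
    greatest (dominance_order n (spm_fixed_points n)) (SPM_fixed_point n) (spm_fixed_points n) \<and>
    least (dominance_order n (spm_fixed_points n)) (replicate n 1) (spm_fixed_points n) \<and>
    (\<forall>a\<in>spm_fixed_points n. \<forall>b\<in>spm_fixed_points n.
      dominance n b a \<longleftrightarrow> dominance n (dual a) (dual b))"
proof (intro conjI ballI)
  show "bij_betw dual (spm_fixed_points n) (strict_partitions n)"
    using dual_spm_fixed_points[OF assms] dual_strict_partitions
    by (intro bij_betw_byWitness[where f' = dual])
      (auto simp: spm_fixed_points_def strict_partitions_def dual_dual)
  show "lattice (dominance_order n (spm_fixed_points n))"
    by (rule lattice_spm_fixed_points[OF assms])
  have "SPM_fixed_point n \<in> SPM n \<and> SPM_fixed_point n \<in> spm_fixed_points n"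
    unfolding SPM_fixed_point_def by (rule theI'[OF ex1_SPM_fixed_point[OF assms]])
  then show "greatest (dominance_order n (spm_fixed_points n)) (SPM_fixed_point n)
      (spm_fixed_points n)"
    using SPM_dominates_blocked[OF assms] by (auto simp: greatest_def dominance_order_def)
  show "least (dominance_order n (spm_fixed_points n)) (replicate n 1) (spm_fixed_points n)"
    using replicate_1_blocked[of n] replicate_1_least
    by (auto simp: least_def dominance_order_def spm_fixed_points_def)
  show "dominance n b a \<longleftrightarrow> dominance n (dual a) (dual b)"
    if "a \<in> spm_fixed_points n" "b \<in> spm_fixed_points n" for a b
    using that by (simp add: dominance_dual_iff spm_fixed_points_def)
qed

end
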